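(* Let $p,t$ be positive integers, let $n_1,\dots,n_p$ be positive integers, let $X=[n]$ with $n=n_1+\cdots+n_p$, partitioned into consecutive blocks $X_1=[n_1]$ and $X_i=\left[\sum_{j\le i}n_j\right]\setminus\left[\sum_{j\le i-1}n_j\right]$ for $i=2,\dots,p$. Let $\mathcal{R}\subset(\mathbb{Z}^+)^p$ be a non-empty finite set and put $$\mathcal{H}_2=\bigcup_{(r_1,\dots,r_p)\in\mathcal{R}}\left\{F\subset X:|F\cap X_i|=r_i,\ i=1,\dots,p\right\}.$$ Let $b$ and $c$ denote respectively the maximum and the minimum of all numbers appearing as coordinates of elements of $\mathcal{R}$. Suppose $t\le c$ and $n_i>2(t+1)pb^{t+2}$ for every $i\in[p]$. Then every $t$-intersecting subfamily $\mathcal{F}\subset\mathcal{H}_2$ of maximum size is trivial, i.e. there is a $t$-subset $T\subset X$ contained in every member of $\mathcal{F}$.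
   Context: A family $\mathcal{F}$ is $t$-intersecting if $|A\cap B|\ge t$ for all $A,B\in\mathcal{F}$. $[m]=\{1,\dots,m\}$. *)

theory Defs
  imports Main "HOL-Library.FuncSet"
begin

definition t_intersecting :: "nat \<Rightarrow> 'a set set \<Rightarrow> bool" where
  "t_intersecting t \<F> \<longleftrightarrow> (\<forall>A\<in>\<F>. \<forall>B\<in>\<F>. t \<le> card (A \<inter> B))"

definition ground :: "nat \<Rightarrow> (nat \<Rightarrow> nat) \<Rightarrow> nat set" where
  "ground p n = {1..(\<Sum>j=1..p. n j)}"

text \<open>For \<open>i = 1\<close> the subtracted set is empty, so the first block is \<open>{1..n 1}\<close>.\<close>

definition block :: "(nat \<Rightarrow> nat) \<Rightarrow> nat \<Rightarrow> nat set" where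
  "block n i = {1..(\<Sum>j=1..i. n j)} - {1..(\<Sum>j=1..i - 1. n j)}"

text \<open>The \<open>p\<close>-tuples of positive integers, as extensional functions on \<open>{1..p}\<close>.\<close>

definition pos_tuples :: "nat \<Rightarrow> (nat \<Rightarrow> nat) set" where
  "pos_tuples p = {1..p} \<rightarrow>\<^sub>E {0<..}"

definition H2 :: "nat \<Rightarrow> (nat \<Rightarrow> nat) \<Rightarrow> (nat \<Rightarrow> nat) set \<Rightarrow> nat set set" where
  "H2 p n R = (\<Union>r\<in>R. {F. F \<subseteq> ground p n \<and> (\<forall>i\<in>{1..p}. card (F \<inter> block n i) = r i)})"

definition coords :: "nat \<Rightarrow> (nat \<Rightarrow> nat) set \<Rightarrow> nat set" where
  "coords p R = {r i | r i. r \<in> R \<and> i \<in> {1..p}}"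

definition max_t_intersecting_in :: "nat \<Rightarrow> 'a set set \<Rightarrow> 'a set set \<Rightarrow> bool" where
  "max_t_intersecting_in t \<H> \<F> \<longleftrightarrow>
     \<F> \<subseteq> \<H> \<and> t_intersecting t \<F> \<and>
     (\<forall>\<G>. \<G> \<subseteq> \<H> \<and> t_intersecting t \<G> \<longrightarrow> card \<G> \<le> card \<F>)"

definition trivial_family :: "nat \<Rightarrow> 'a set \<Rightarrow> 'a set set \<Rightarrow> bool" where
  "trivial_family t X \<F> \<longleftrightarrow> (\<exists>T. T \<subseteq> X \<and> card T = t \<and> (\<forall>A\<in>\<F>. T \<subseteq> A))"

end

theory Submission
  imports Defs Complex_Main "HOL-Combinatorics.Transposition"
begin

text \<open>
  Treat each tuple \<open>r \<in> R\<close> separately. In its layer \<open>H\<close>, forcing one more point into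
  a set divides the number of members containing it by at least \<open>1/q\<close>, where \<open>q = b/m\<close> and
  \<open>m\<close> is the smallest block size; every member has at most \<open>k = pb\<close> points. If \<open>G\<close> is the part of
  a \<open>t\<close>-intersecting family containing a set \<open>I\<close> with \<open>|I| = t - s < t\<close>, and \<open>x\<close> is the point
  outside \<open>I\<close> of largest degree in \<open>G\<close>, then for every other \<open>y\<close> the members of \<open>G\<close> containing
  \<open>x\<close> but not \<open>y\<close> and those containing \<open>y\<close> but not \<open>x\<close> are cross-\<open>s\<close>-intersecting outside
  \<open>I\<close>, so the smaller of these two classes has relative density at most \<open>(2q)^s\<close>. Summing over the points
  \<open>y\<close> of one member avoiding \<open>x\<close>, all but about \<open>2^s k q^(t+1) |H|\<close> members of \<open>G\<close> contain
  \<open>x\<close>. After \<open>t\<close> such steps we reach a \<open>t\<close>-set \<open>T\<close>; if the family is nontrivial, all remaining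
  members must meet some fixed member outside \<open>T\<close>, so there are at most \<open>k q^(t+1) |H|\<close> of them. The
  total is less than \<open>t! |H| / m^t\<close>, a lower bound for the number of members of \<open>H\<close> that
  contain a \<open>t\<close>-subset \<open>T0\<close> of the smallest block. Since \<open>T0\<close> is the same for all \<open>r\<close>, the star of
  \<open>T0\<close> is larger than the family.
\<close>

section \<open>Degrees of point sets in a family\<close>

definition containing :: "'a set set \<Rightarrow> 'a set \<Rightarrow> 'a set set" where
  "containing H S = {F \<in> H. S \<subseteq> F}"

lemma containing_subset: "containing H S \<subseteq> H"
  by (auto simp: containing_def)

lemma containing_empty [simp]: "containing H {} = H"
  by (auto simp: containing_def)

text \<open>Double counting of the pairs \<open>(y, F)\<close> with \<open>y \<in> F\<close>. It
  serves both the averaging over the points of one member and the exact degree count in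
  layers.\<close>

lemma sum_card_containing_insert:
  assumes "finite H" and "finite Y"
  shows "(\<Sum>y\<in>Y. card (containing H (insert y S))) = (\<Sum>F\<in>containing H S. card (F \<inter> Y))"
proof -
  have fin: "finite (containing H S)"
    using assms containing_subset by (rule_tac finite_subset)
  have "(\<Sum>y\<in>Y. card (containing H (insert y S)))
      = (\<Sum>y\<in>Y. \<Sum>F\<in>containing H S. if y \<in> F then 1 else 0)"
  proof (rule sum.cong)
    fix y
    have "containing H (insert y S) = {F \<in> containing H S. y \<in> F}"
      by (auto simp: containing_def)
    then show "card (containing H (insert y S)) = (\<Sum>F\<in>containing H S. if y \<in> F then 1 else 0)"
      using fin by (simp add: sum.If_cases Int_def)
  qed simp
  also have "\<dots> = (\<Sum>F\<in>containing H S. \<Sum>y\<in>Y. if y \<in> F then 1 else 0)"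
    by (rule sum.swap)
  also have "\<dots> = (\<Sum>F\<in>containing H S. card (F \<inter> Y))"
    using assms(2) by (intro sum.cong) (auto simp: sum.If_cases Int_def conj_commute)
  finally show ?thesis .
qed

section \<open>Spread families: cross-intersecting pairs and nontrivial subfamilies\<close>

locale spread_family =
  fixes H :: "'a set set" and k :: nat and q :: real
  assumes finite_H: "finite H"
    and finite_member: "F \<in> H \<Longrightarrow> finite F"
    and card_member: "F \<in> H \<Longrightarrow> card F \<le> k"
    and q_nonneg: "0 \<le> q"
    and q_le: "4 * q \<le> 1"
    and kq_less: "2 * real k * q < 1"
    and spread: "x \<notin> S \<Longrightarrow>
      real (card (containing H (insert x S))) \<le> q * real (card (containing H S))"
begin

lemma finite_sub: "\<A> \<subseteq> H \<Longrightarrow> finite \<A>"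
  using finite_H finite_subset by blast

lemma finite_containing [simp]: "finite (containing H S)"
  by (intro finite_sub containing_subset)

text \<open>If a pair of families beats the bound, splitting both by membership of a point
  \<open>x\<close> and applying the bound to the parts shows that at most a fraction \<open>2q\<close> of \<open>\<A>\<close>
  contains \<open>x\<close>. Summing over the points of one member of \<open>\<B>\<close> contradicts \<open>2kq < 1\<close>.\<close>

lemma cross_intersecting_bound:
  assumes "\<A> \<subseteq> containing H P" and "\<B> \<subseteq> containing H Q"
    and "\<And>A B. A \<in> \<A> \<Longrightarrow> B \<in> \<B> \<Longrightarrow> s \<le> card ((A \<inter> B) - (P \<union> Q))"
  shows "real (card \<A>) * real (card \<B>)
    \<le> (2 * q) ^ (2 * s) * (real (card (containing H P)) * real (card (containing H Q)))"
  using assms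
\<comment> \<open>The measure is the room left below size \<open>k\<close>. Subtraction is
  truncated, so it drops only if the set being enlarged has fewer than \<open>k\<close> points;
  \<open>kQ\<close> gets this from \<open>B0\<close>, and \<open>kP\<close> from a member of
  \<open>A1\<close>.\<close>
proof (induction "(k - card P) + (k - card Q)" arbitrary: P Q \<A> \<B> s rule: less_induct)
  case less
  note A = less.prems(1) and B = less.prems(2) and int = less.prems(3)
  let ?D = "real (card (containing H P)) * real (card (containing H Q))"
  have AH: "\<A> \<subseteq> H" and BH: "\<B> \<subseteq> H" using A B containing_subset by blast+
  have finA: "finite \<A>" and finB: "finite \<B>" using AH BH finite_sub by blast+
  consider "\<A> = {} \<or> \<B> = {}" | "s = 0" | "\<A> \<noteq> {}" "\<B> \<noteq> {}" "s > 0" by blast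
  then show ?case
  proof cases
    case 1
    then show ?thesis using q_nonneg by (auto intro!: mult_nonneg_nonneg)
  next
    case 2
    have "real (card \<A>) \<le> real (card (containing H P))"
      "real (card \<B>) \<le> real (card (containing H Q))"
      using card_mono[OF finite_containing A] card_mono[OF finite_containing B] by simp_all
    then show ?thesis using 2 by (simp add: mult_mono)
  next
    case 3
    obtain A0 B0 where A0: "A0 \<in> \<A>" and B0: "B0 \<in> \<B>" using 3 by blast
    have PA: "P \<subseteq> A0" and QB: "Q \<subseteq> B0" using A B A0 B0 by (auto simp: containing_def)
    have finA0: "finite A0" and finB0: "finite B0" using AH BH A0 B0 finite_member by blast+
    have finP: "finite P" and finQ: "finite Q" using PA QB finA0 finB0 finite_subset by blast+
    show ?thesis
    proof (rule ccontr)
      assume neg: "\<not> ?thesis"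
      define a where "a = real (card \<A>)"
      define b where "b = real (card \<B>)"
      have big: "(2 * q) ^ (2 * s) * ?D < a * b" using neg by (simp add: a_def b_def)
      have apos: "a > 0" and bpos: "b > 0"
        using 3 finA finB by (auto simp: a_def b_def card_gt_0_iff)
      have few: "real (card {A \<in> \<A>. x \<in> A}) \<le> 2 * q * a" if x: "x \<in> B0 - (P \<union> Q)" for x
      proof -
        define A1 where "A1 = {A \<in> \<A>. x \<in> A}"
        define A2 where "A2 = {A \<in> \<A>. x \<notin> A}"
        define B1 where "B1 = {B \<in> \<B>. x \<in> B}"
        define B2 where "B2 = {B \<in> \<B>. x \<notin> B}"
        define u where "u = real (card A1)"
        define v where "v = real (card B1)"
        have "card \<A> = card A1 + card A2"
          unfolding A1_def A2_def using finA
          by (subst card_Un_disjoint[symmetric]) (auto intro!: arg_cong[where f = card])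
        then have u2: "real (card A2) = a - u" by (simp add: a_def u_def)
        have "card \<B> = card B1 + card B2"
          unfolding B1_def B2_def using finB
          by (subst card_Un_disjoint[symmetric]) (auto intro!: arg_cong[where f = card])
        then have v2: "real (card B2) = b - v" by (simp add: b_def v_def)
        have u0: "0 \<le> u" and v0: "0 \<le> v" by (simp_all add: u_def v_def)
        have ua: "u \<le> a" and vb: "v \<le> b" using u2 v2 by linarith+
        let ?dP = "real (card (containing H P))"
        let ?dQ = "real (card (containing H Q))"
        let ?dP' = "real (card (containing H (insert x P)))"
        let ?dQ' = "real (card (containing H (insert x Q)))"
        have dP': "?dP' \<le> q * ?dP" and dQ': "?dQ' \<le> q * ?dQ" using spread x by auto
        have s1: "A1 \<subseteq> containing H (insert x P)" "B1 \<subseteq> containing H (insert x Q)"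
          "A2 \<subseteq> containing H P" "B2 \<subseteq> containing H Q"
          using A B by (auto simp: A1_def B1_def A2_def B2_def containing_def)
        have "card (insert x Q) \<le> card B0"
          using x QB finB0 by (intro card_mono) auto
        then have kQ: "card Q < k" using card_member[of B0] B0 BH x finQ by auto
        have incP: "card (insert x P) = Suc (card P)" and incQ: "card (insert x Q) = Suc (card Q)"
          using x finP finQ by auto
        have meas2: "(k - card P) + (k - card (insert x Q)) < (k - card P) + (k - card Q)"
          using kQ incQ by linarith
        have kP: "card P < k" if ne: "A1 \<noteq> {}"
        proof -
          obtain A' where A': "A' \<in> \<A>" "x \<in> A'" using ne by (auto simp: A1_def)
          then have "insert x P \<subseteq> A'" "finite A'" "card A' \<le> k"
            using A AH finite_member card_member by (auto simp: containing_def)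
          then have "card (insert x P) \<le> k" using card_mono order_trans by blast
          then show ?thesis using incP by simp
        qed
        \<comment> \<open>Here \<open>x\<close> itself may be a common point, so only
          \<open>s - 1\<close> common points are left outside the enlarged sets.\<close>
        have b12: "u * v \<le> (2 * q) ^ (2 * (s - 1)) * (?dP' * ?dQ')"
        proof (cases "A1 = {}")
          case True
          then show ?thesis using q_nonneg by (simp add: u_def)
        next
          case False
          have "(k - card (insert x P)) + (k - card (insert x Q)) < (k - card P) + (k - card Q)"
            using kP[OF False] kQ incP incQ by linarith
          moreover have "s - 1 \<le> card (A \<inter> B - (insert x P \<union> insert x Q))"
            if "A \<in> A1" "B \<in> B1" for A B
          proof -
            have "A \<inter> B - (insert x P \<union> insert x Q) = (A \<inter> B - (P \<union> Q)) - {x}" by auto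
            moreover have "s \<le> card (A \<inter> B - (P \<union> Q))"
              using int that by (auto simp: A1_def B1_def)
            ultimately show ?thesis
              using diff_card_le_card_Diff[of "{x}" "A \<inter> B - (P \<union> Q)"] by simp
          qed
          ultimately show ?thesis unfolding u_def v_def by (intro less.hyps s1)
        qed
        \<comment> \<open>A pair that does not share \<open>x\<close> loses no common point when
          \<open>x\<close> joins \<open>P\<close> or \<open>Q\<close>.\<close>
        have sep: "s \<le> card (A \<inter> B - (insert x P \<union> Q))" "s \<le> card (A \<inter> B - (P \<union> insert x Q))"
          if "A \<in> \<A>" "B \<in> \<B>" "x \<notin> A \<inter> B" for A B
        proof -
          have "A \<inter> B - (insert x P \<union> Q) = A \<inter> B - (P \<union> Q)"
            "A \<inter> B - (P \<union> insert x Q) = A \<inter> B - (P \<union> Q)" using that(3) by auto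
          then show "s \<le> card (A \<inter> B - (insert x P \<union> Q))" "s \<le> card (A \<inter> B - (P \<union> insert x Q))"
            using int that by auto
        qed
        have b1: "u * (b - v) \<le> (2 * q) ^ (2 * s) * (?dP' * ?dQ)"
        proof (cases "A1 = {}")
          case True
          then show ?thesis using q_nonneg by (simp add: u_def)
        next
          case False
          have "(k - card (insert x P)) + (k - card Q) < (k - card P) + (k - card Q)"
            using kP[OF False] incP by linarith
          then show ?thesis unfolding u_def v2[symmetric]
            by (intro less.hyps s1 sep) (auto simp: A1_def B2_def)
        qed
        have b2: "(a - u) * v \<le> (2 * q) ^ (2 * s) * (?dP * ?dQ')"
          unfolding v_def u2[symmetric]
          by (intro less.hyps meas2 s1 sep) (auto simp: A2_def B1_def)
        have q0: "0 \<le> (2 * q) ^ m" for m using q_nonneg by simp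
        have "u * v \<le> (2 * q) ^ (2 * (s - 1)) * ((q * ?dP) * (q * ?dQ))"
          using b12 q0 dP' dQ' q_nonneg
          by (meson mult_left_mono mult_mono mult_nonneg_nonneg of_nat_0_le_iff order_trans)
        \<comment> \<open>The lost common point costs a factor \<open>(2 * q) ^ 2\<close>, and the
          two spread factors return \<open>q ^ 2\<close>; what remains is the gain of 1/4.\<close>
        also have "\<dots> = (2 * q) ^ (2 * s) * ?D / 4"
        proof -
          obtain m where "s = Suc m" using \<open>s > 0\<close> gr0_implies_Suc by blast
          then show ?thesis by (simp add: power2_eq_square algebra_simps)
        qed
        finally have uv: "u * v \<le> a * b / 4" using big by linarith
        have "u * (b - v) \<le> (2 * q) ^ (2 * s) * ((q * ?dP) * ?dQ)"
          using b1 q0 dP' by (meson mult_left_mono mult_right_mono of_nat_0_le_iff order_trans)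
        also have "\<dots> = q * ((2 * q) ^ (2 * s) * ?D)" by (simp add: algebra_simps)
        also have "\<dots> \<le> q * (a * b)" using big q_nonneg by (intro mult_left_mono) auto
        finally have ubv: "u * (b - v) \<le> q * (a * b)" .
        have "(a - u) * v \<le> (2 * q) ^ (2 * s) * (?dP * (q * ?dQ))"
          using b2 q0 dQ' by (meson mult_left_mono of_nat_0_le_iff order_trans)
        also have "\<dots> = q * ((2 * q) ^ (2 * s) * ?D)" by (simp add: algebra_simps)
        also have "\<dots> \<le> q * (a * b)" using big q_nonneg by (intro mult_left_mono) auto
        finally have auv: "(a - u) * v \<le> q * (a * b)" .
        have small: "u \<le> 2 * q * a" if "v \<le> b / 2"
        proof -
          have "u * (b / 2) \<le> u * (b - v)" using that u0 by (intro mult_left_mono) auto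
          then have "u * (b / 2) \<le> q * (a * b)" using ubv by linarith
          then have "u * b \<le> (2 * q * a) * b" by (simp add: algebra_simps)
          then show ?thesis using bpos by simp
        qed
        \<comment> \<open>Otherwise \<open>uv\<close> forces \<open>u \<le> a / 2\<close>, then
          \<open>auv\<close> gives \<open>v \<le> 2 * q * b\<close>, and this is at most
          \<open>b / 2\<close> because \<open>4 * q \<le> 1\<close>.\<close>
        moreover have "v \<le> b / 2"
        proof (rule ccontr)
          assume "\<not> v \<le> b / 2"
          then have v: "b / 2 < v" by simp
          have "u \<le> a / 2"
          proof (rule ccontr)
            assume "\<not> u \<le> a / 2"
            then have "(a / 2) * (b / 2) < u * v"
              using v apos bpos by (intro mult_strict_mono) auto
            then show False using uv by simp
          qed
          then have "(a / 2) * v \<le> (a - u) * v" using v0 by (intro mult_right_mono) auto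
          then have "(a / 2) * v \<le> q * (a * b)" using auv by linarith
          then have "a * v \<le> a * (2 * q * b)" by (simp add: algebra_simps)
          then have "v \<le> 2 * q * b" using apos by simp
          also have "\<dots> \<le> b / 2" using mult_right_mono[OF q_le, of b] bpos by simp
          finally show False using v by simp
        qed
        ultimately show ?thesis by (simp add: u_def A1_def)
      qed
      let ?Y = "B0 - (P \<union> Q)"
      have finY: "finite ?Y" using finB0 by simp
      have "real s * a \<le> (\<Sum>A\<in>\<A>. real (card (A \<inter> ?Y)))"
      proof -
        have "real s \<le> real (card (A \<inter> ?Y))" if "A \<in> \<A>" for A
          using int[OF that B0] by (simp add: Int_Diff)
        then have "(\<Sum>A\<in>\<A>. real s) \<le> (\<Sum>A\<in>\<A>. real (card (A \<inter> ?Y)))" by (rule sum_mono)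
        then show ?thesis by (simp add: a_def mult.commute)
      qed
      also have "\<dots> = (\<Sum>x\<in>?Y. real (card {A \<in> \<A>. x \<in> A}))"
        using arg_cong[where f = real, OF sum_card_containing_insert[OF finA finY, of "{}"]]
        by (simp add: containing_def)
      also have "\<dots> \<le> (\<Sum>x\<in>?Y. 2 * q * a)" by (intro sum_mono few)
      also have "\<dots> = real (card ?Y) * (2 * q * a)" by simp
      also have "\<dots> \<le> real k * (2 * q * a)"
      proof -
        have "card ?Y \<le> k"
          using card_mono[OF finB0, of ?Y] card_member[of B0] B0 BH by auto
        then show ?thesis using q_nonneg apos by (intro mult_right_mono) auto
      qed
      also have "\<dots> = (2 * real k * q) * a" by simp
      also have "\<dots> < 1 * a" using kq_less apos by (intro mult_strict_right_mono)
      finally have "real s < 1" using apos by simp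
      then show False using \<open>s > 0\<close> by simp
    qed
  qed
qed

text \<open>One greedy step towards a common \<open>t\<close>-set. As \<open>x\<close> has largest
  degree, the class \<open>V\<close> of members through \<open>y\<close> but not \<open>x\<close> is
  no larger than the opposite class \<open>U\<close>, so the cross-intersecting bound on their
  product bounds the square of \<open>card V\<close>. Every member avoiding \<open>x\<close> meets a
  fixed member \<open>A\<close> avoiding \<open>x\<close> in some \<open>y \<in> A - I\<close>,
  which gives the factor \<open>k\<close>.\<close>

lemma popular_point:
  assumes F: "\<F> \<subseteq> H" and tF: "t_intersecting t \<F>"
    and I: "finite I" "card I < t" and ne: "containing \<F> I \<noteq> {}"
  obtains x where "x \<notin> I"
    and "real (card {F \<in> containing \<F> I. x \<notin> F})
      \<le> real k * ((2 * q) ^ (t - card I) * q * real (card (containing H I)))"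
proof -
  define G where "G = containing \<F> I"
  define s where "s = t - card I"
  have GF: "G \<subseteq> \<F>" and GH: "G \<subseteq> H" using F by (auto simp: G_def containing_def)
  have finG: "finite G" using GH finite_sub by blast
  have IG: "I \<subseteq> A" if "A \<in> G" for A using that by (auto simp: G_def containing_def)
  have int: "s \<le> card (A \<inter> B - I)" if "A \<in> G" "B \<in> G" for A B
  proof -
    have "t \<le> card (A \<inter> B)" using tF that GF by (auto simp: t_intersecting_def)
    then show ?thesis using card_Diff_subset[OF I(1), of "A \<inter> B"] IG[OF that(1)] IG[OF that(2)]
      by (simp add: s_def)
  qed
  have spos: "s > 0" using I by (simp add: s_def)
  define Y where "Y = \<Union>G - I"
  have finY: "finite Y" using finG GH finite_member by (auto simp: Y_def)
  obtain A0 where A0: "A0 \<in> G" using ne by (auto simp: G_def)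
  have "card (A0 - I) > 0" using int[OF A0 A0] spos by simp
  then have "A0 - I \<noteq> {}" by (metis card.empty less_irrefl)
  then have Yne: "Y \<noteq> {}" using A0 by (auto simp: Y_def)
  let ?g = "\<lambda>x. card {F \<in> G. x \<in> F}"
  have "Max (?g ` Y) \<in> ?g ` Y" using finY Yne by (intro Max_in) auto
  then obtain x where x: "x \<in> Y" "?g x = Max (?g ` Y)" by auto
  have xmax: "?g y \<le> ?g x" if "y \<in> Y" for y
    using x(2) finY that by simp
  let ?d = "real (card (containing H I))"
  have "real (card {F \<in> G. x \<notin> F}) \<le> real k * ((2 * q) ^ s * q * ?d)"
  proof (cases "{F \<in> G. x \<notin> F} = {}")
    case True
    then have "real (card {F \<in> G. x \<notin> F}) = 0" by (metis card.empty of_nat_0)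
    then show ?thesis using q_nonneg by simp
  next
    case False
    then obtain A where A: "A \<in> G" "x \<notin> A" by blast
    have finA: "finite A" and cardA: "card A \<le> k" using A GH finite_member card_member by blast+
    have few: "real (card {F \<in> G. x \<notin> F \<and> y \<in> F}) \<le> (2 * q) ^ s * q * ?d" if y: "y \<in> A - I" for y
    proof -
      have yY: "y \<in> Y" and xy: "x \<noteq> y" using y A by (auto simp: Y_def)
      define U where "U = {F \<in> G. x \<in> F \<and> y \<notin> F}"
      define V where "V = {F \<in> G. x \<notin> F \<and> y \<in> F}"
      define W where "W = {F \<in> G. x \<in> F \<and> y \<in> F}"
      have fin: "finite U" "finite V" "finite W" using finG by (auto simp: U_def V_def W_def)
      have "?g x = card U + card W"
        by (subst card_Un_disjoint[symmetric])
          (use fin in \<open>auto simp: U_def W_def intro!: arg_cong[where f = card]\<close>)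
      moreover have "?g y = card V + card W"
        by (subst card_Un_disjoint[symmetric])
          (use fin in \<open>auto simp: V_def W_def intro!: arg_cong[where f = card]\<close>)
      ultimately have VU: "card V \<le> card U" using xmax[OF yY] by simp
      have "real (card U) * real (card V) \<le> (2 * q) ^ (2 * s) *
        (real (card (containing H (insert x I))) * real (card (containing H (insert y I))))"
      proof (rule cross_intersecting_bound)
        show "U \<subseteq> containing H (insert x I)" "V \<subseteq> containing H (insert y I)"
          using GH IG by (auto simp: U_def V_def containing_def)
        fix A B assume AB: "A \<in> U" "B \<in> V"
        \<comment> \<open>A common point of a set in \<open>U\<close> and a set in \<open>V\<close>
          is neither \<open>x\<close> nor \<open>y\<close>, so all \<open>s\<close> common points
          survive.\<close>
        then have "A \<inter> B - (insert x I \<union> insert y I) = A \<inter> B - I"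
          by (auto simp: U_def V_def)
        then show "s \<le> card (A \<inter> B - (insert x I \<union> insert y I))"
          using int AB by (auto simp: U_def V_def)
      qed
      also have "\<dots> \<le> (2 * q) ^ (2 * s) * ((q * ?d) * (q * ?d))"
        using spread[of x I] spread[of y I] x y q_nonneg
        by (intro mult_left_mono mult_mono) (auto simp: Y_def)
      also have "\<dots> = ((2 * q) ^ s * q * ?d)\<^sup>2"
        unfolding power_even_eq by (simp add: power2_eq_square mult.assoc mult.left_commute)
      finally have UV: "real (card U) * real (card V) \<le> ((2 * q) ^ s * q * ?d)\<^sup>2" .
      have "(real (card V))\<^sup>2 \<le> real (card U) * real (card V)"
        using VU by (simp add: power2_eq_square mult_right_mono)
      then have "(real (card V))\<^sup>2 \<le> ((2 * q) ^ s * q * ?d)\<^sup>2" using UV by linarith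
      then show ?thesis unfolding V_def using q_nonneg by (rule_tac power2_le_imp_le) auto
    qed
    have "{F \<in> G. x \<notin> F} \<subseteq> (\<Union>y\<in>A - I. {F \<in> G. x \<notin> F \<and> y \<in> F})"
    proof
      fix F assume F: "F \<in> {F \<in> G. x \<notin> F}"
      then have "card (F \<inter> A - I) > 0" using int[of F A] A spos by simp
      then have "F \<inter> A - I \<noteq> {}" by (metis card.empty less_irrefl)
      then show "F \<in> (\<Union>y\<in>A - I. {F \<in> G. x \<notin> F \<and> y \<in> F})" using F by auto
    qed
    then have "card {F \<in> G. x \<notin> F} \<le> card (\<Union>y\<in>A - I. {F \<in> G. x \<notin> F \<and> y \<in> F})"
      using finA finG by (intro card_mono) auto
    also have "\<dots> \<le> (\<Sum>y\<in>A - I. card {F \<in> G. x \<notin> F \<and> y \<in> F})"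
      using finA by (intro card_UN_le) auto
    finally have "real (card {F \<in> G. x \<notin> F}) \<le> (\<Sum>y\<in>A - I. real (card {F \<in> G. x \<notin> F \<and> y \<in> F}))"
      by (simp flip: of_nat_sum)
    also have "\<dots> \<le> (\<Sum>y\<in>A - I. (2 * q) ^ s * q * ?d)" by (intro sum_mono few)
    also have "\<dots> = real (card (A - I)) * ((2 * q) ^ s * q * ?d)" by simp
    also have "\<dots> \<le> real k * ((2 * q) ^ s * q * ?d)"
    proof -
      have "card (A - I) \<le> k" using card_mono[OF finA, of "A - I"] cardA by auto
      then show ?thesis using q_nonneg by (intro mult_right_mono) auto
    qed
    finally show ?thesis .
  qed
  then show thesis using x that by (auto simp: G_def s_def Y_def)
qed

lemma nontrivial_card_containing_bound:
  assumes F: "\<F> \<subseteq> H" and tF: "t_intersecting t \<F>"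
    and nontriv: "\<And>T. finite T \<Longrightarrow> card T = t \<Longrightarrow>
      \<exists>B. finite B \<and> card B \<le> k \<and> \<not> T \<subseteq> B \<and> (\<forall>A\<in>\<F>. t \<le> card (A \<inter> B))"
    and I: "finite I" "card I + s = t"
  shows "real (card (containing \<F> I))
    \<le> (2 ^ Suc s - 1) * real k * q ^ Suc s * real (card (containing H I))"
  using I
proof (induction s arbitrary: I)
  case 0
  obtain B where B: "finite B" "card B \<le> k" "\<not> I \<subseteq> B" "\<And>A. A \<in> \<F> \<Longrightarrow> t \<le> card (A \<inter> B)"
    using nontriv[of I] 0 by auto
  have "containing \<F> I \<subseteq> (\<Union>y\<in>B - I. containing H (insert y I))"
  proof
    fix A assume A: "A \<in> containing \<F> I"
    then have IA: "I \<subseteq> A" "A \<in> \<F>" "A \<in> H" using F by (auto simp: containing_def)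
    have "A \<inter> B - I \<noteq> {}"
    proof
      assume "A \<inter> B - I = {}"
      then have "A \<inter> B \<subset> I" using B(3) by blast
      then have "card (A \<inter> B) < card I" using 0(1) psubset_card_mono by blast
      then show False using B(4)[OF IA(2)] 0 by simp
    qed
    then show "A \<in> (\<Union>y\<in>B - I. containing H (insert y I))" using IA by (auto simp: containing_def)
  qed
  then have "card (containing \<F> I) \<le> card (\<Union>y\<in>B - I. containing H (insert y I))"
    using B(1) by (intro card_mono) auto
  also have "\<dots> \<le> (\<Sum>y\<in>B - I. card (containing H (insert y I)))"
    using B(1) by (intro card_UN_le) auto
  finally have "real (card (containing \<F> I)) \<le> (\<Sum>y\<in>B - I. real (card (containing H (insert y I))))"
    by (simp flip: of_nat_sum)
  also have "\<dots> \<le> (\<Sum>y\<in>B - I. q * real (card (containing H I)))"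
    by (intro sum_mono spread) auto
  also have "\<dots> = real (card (B - I)) * (q * real (card (containing H I)))" by simp
  also have "\<dots> \<le> real k * (q * real (card (containing H I)))"
  proof -
    have "card (B - I) \<le> k" using card_mono[OF B(1), of "B - I"] B(2) by auto
    then show ?thesis using q_nonneg by (intro mult_right_mono) auto
  qed
  finally show ?case by simp
next
  case (Suc s)
  let ?d = "real (card (containing H I))"
  show ?case
  proof (cases "containing \<F> I = {}")
    case True
    have "(1::real) \<le> 2 ^ Suc (Suc s)" by (rule one_le_power) simp
    then show ?thesis using True q_nonneg by simp
  next
    case False
    have "card I < t" "t - card I = Suc s" using Suc.prems by auto
    then obtain x where x: "x \<notin> I"
      "real (card {F \<in> containing \<F> I. x \<notin> F}) \<le> real k * ((2 * q) ^ Suc s * q * ?d)"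
      using popular_point[OF F tF Suc.prems(1) _ False] by metis
    have fin: "finite (containing \<F> I)" using F finite_sub containing_subset by blast
    have "card (containing \<F> I) = card (containing \<F> (insert x I)) + card {F \<in> containing \<F> I. x \<notin> F}"
      by (subst card_Un_disjoint[symmetric])
        (use fin in \<open>auto simp: containing_def intro!: arg_cong[where f = card] elim: rev_finite_subset\<close>)
    then have "real (card (containing \<F> I)) \<le> real (card (containing \<F> (insert x I)))
        + real k * ((2 * q) ^ Suc s * q * ?d)"
      using x(2) by simp
    also have "real (card (containing \<F> (insert x I)))
        \<le> (2 ^ Suc s - 1) * real k * q ^ Suc s * real (card (containing H (insert x I)))"
      using Suc.prems x(1) by (intro Suc.IH) auto
    also have "\<dots> \<le> (2 ^ Suc s - 1) * real k * q ^ Suc s * (q * ?d)"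
    proof -
      have "(1::real) \<le> 2 ^ Suc s" by (rule one_le_power) simp
      then show ?thesis using q_nonneg spread[OF x(1)] by (intro mult_left_mono) auto
    qed
    also have "(2 ^ Suc s - 1) * real k * q ^ Suc s * (q * ?d) + real k * ((2 * q) ^ Suc s * q * ?d)
        = (2 ^ Suc (Suc s) - 1) * real k * q ^ Suc (Suc s) * ?d"
      by (simp add: power_mult_distrib algebra_simps)
    finally show ?thesis by simp
  qed
qed

lemma nontrivial_card_bound:
  assumes "\<F> \<subseteq> H" and "t_intersecting t \<F>"
    and "\<And>T. finite T \<Longrightarrow> card T = t \<Longrightarrow>
      \<exists>B. finite B \<and> card B \<le> k \<and> \<not> T \<subseteq> B \<and> (\<forall>A\<in>\<F>. t \<le> card (A \<inter> B))"
  shows "real (card \<F>) \<le> (2 ^ Suc t - 1) * real k * q ^ Suc t * real (card H)"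
  using nontrivial_card_containing_bound[OF assms, where I = "{}" and s = t] by simp

end


section \<open>Layers of a block system and their degrees\<close>

definition layer :: "'i set \<Rightarrow> ('i \<Rightarrow> 'a set) \<Rightarrow> ('i \<Rightarrow> nat) \<Rightarrow> 'a set set" where
  "layer J B r = {F. F \<subseteq> (\<Union>i\<in>J. B i) \<and> (\<forall>i\<in>J. card (F \<inter> B i) = r i)}"

locale block_system =
  fixes J :: "'i set" and B :: "'i \<Rightarrow> 'a set"
  assumes finite_J: "finite J"
    and finite_block: "i \<in> J \<Longrightarrow> finite (B i)"
    and disjoint_blocks: "i \<in> J \<Longrightarrow> j \<in> J \<Longrightarrow> i \<noteq> j \<Longrightarrow> B i \<inter> B j = {}"
begin

lemma finite_ground: "finite (\<Union>i\<in>J. B i)"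
  using finite_J finite_block by blast

lemma finite_layer: "finite (layer J B r)"
  by (rule finite_subset[OF _ finite_Pow_iff[THEN iffD2, OF finite_ground]])
    (auto simp: layer_def)

lemma finite_layer_member: "F \<in> layer J B r \<Longrightarrow> finite F"
  using finite_ground finite_subset by (auto simp: layer_def)

lemma card_layer_member:
  assumes "F \<in> layer J B r"
  shows "card F = (\<Sum>i\<in>J. r i)"
proof -
  have "F = (\<Union>i\<in>J. F \<inter> B i)" using assms by (auto simp: layer_def)
  then have "card F = card (\<Union>i\<in>J. F \<inter> B i)" by simp
  also have "\<dots> = (\<Sum>i\<in>J. card (F \<inter> B i))"
    using finite_J finite_block disjoint_blocks by (intro card_UN_disjoint) blast+
  also have "\<dots> = (\<Sum>i\<in>J. r i)" using assms by (intro sum.cong) (auto simp: layer_def)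
  finally show ?thesis .
qed

lemma layer_nonempty:
  assumes "\<And>i. i \<in> J \<Longrightarrow> r i \<le> card (B i)"
  shows "layer J B r \<noteq> {}"
proof -
  have "\<forall>i\<in>J. \<exists>S. S \<subseteq> B i \<and> card S = r i"
    using assms by (meson obtain_subset_with_card_n)
  then obtain f where f: "\<And>i. i \<in> J \<Longrightarrow> f i \<subseteq> B i \<and> card (f i) = r i" by metis
  have "(\<Union>j\<in>J. f j) \<inter> B i = f i" if "i \<in> J" for i
    using f disjoint_blocks that by blast
  then have "(\<Union>j\<in>J. f j) \<in> layer J B r" using f by (fastforce simp: layer_def)
  then show ?thesis by blast
qed

text \<open>Swapping two points of the same block maps every block onto itself, so all intersection
  sizes are kept.\<close>

lemma transpose_image_layer:
  assumes "i \<in> J" "x \<in> B i" "y \<in> B i" "F \<in> layer J B r"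
  shows "transpose x y ` F \<in> layer J B r"
proof -
  have blk: "transpose x y ` B j = B j" if "j \<in> J" for j
  proof (cases "j = i")
    case True
    then show ?thesis using assms by (auto simp: transpose_image_eq)
  next
    case False
    then have "x \<notin> B j" "y \<notin> B j" using assms that disjoint_blocks by blast+
    then show ?thesis by (auto simp: transpose_image_eq)
  qed
  have "transpose x y ` F \<inter> B j = transpose x y ` (F \<inter> B j)" if "j \<in> J" for j
    using blk[OF that] by (metis image_Int inj_transpose)
  then have "card (transpose x y ` F \<inter> B j) = card (F \<inter> B j)" if "j \<in> J" for j
    using that card_image[OF inj_on_subset[OF inj_transpose subset_UNIV], of x y "F \<inter> B j"] by simp
  moreover have "transpose x y ` F \<subseteq> (\<Union>i\<in>J. B i)"
  proof -
    have "transpose x y ` F \<subseteq> (\<Union>i\<in>J. transpose x y ` B i)"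
      using assms(4) by (fastforce simp: layer_def)
    also have "\<dots> = (\<Union>i\<in>J. B i)" using blk by (intro SUP_cong) auto
    finally show ?thesis .
  qed
  ultimately show ?thesis using assms(4) by (simp add: layer_def)
qed

text \<open>The swap of \<open>x\<close> and \<open>y\<close> fixes \<open>S\<close> and is
  injective on sets. Exchanging the roles of \<open>x\<close> and \<open>y\<close> gives equality,
  so the points of a block outside \<open>S\<close> all have the same degree over
  \<open>S\<close>.\<close>

lemma card_containing_insert_le:
  assumes "i \<in> J" "x \<in> B i - S" "y \<in> B i - S"
  shows "card (containing (layer J B r) (insert x S)) \<le> card (containing (layer J B r) (insert y S))"
proof (rule card_inj_on_le)
  show "inj_on (image (transpose x y)) (containing (layer J B r) (insert x S))"
    by (intro inj_onI) (metis inj_image_eq_iff inj_transpose)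
  show "finite (containing (layer J B r) (insert y S))"
    by (rule finite_subset[OF containing_subset finite_layer])
  show "image (transpose x y) ` containing (layer J B r) (insert x S)
      \<subseteq> containing (layer J B r) (insert y S)"
  proof safe
    fix F assume F: "F \<in> containing (layer J B r) (insert x S)"
    have "transpose x y ` S = S" using assms by (auto simp: transpose_image_eq)
    then have "insert y S \<subseteq> transpose x y ` F"
      using F image_mono[of "insert x S" F "transpose x y"] by (simp add: containing_def)
    then show "transpose x y ` F \<in> containing (layer J B r) (insert y S)"
      using F transpose_image_layer[of i x y F r] assms by (auto simp: containing_def)
  qed
qed

text \<open>Double counting over \<open>B i - S\<close>: its points have equal degree over
  \<open>S\<close>, and each member through \<open>S\<close> has exactly
  \<open>r i - card (S \<inter> B i)\<close> points there.\<close>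

lemma card_containing_insert:
  assumes i: "i \<in> J" and x: "x \<in> B i - S"
  shows "(card (B i) - card (S \<inter> B i)) * card (containing (layer J B r) (insert x S))
    = (r i - card (S \<inter> B i)) * card (containing (layer J B r) S)"
proof -
  let ?H = "layer J B r"
  have fin: "finite (B i)" using i finite_block by blast
  have "(card (B i) - card (S \<inter> B i)) * card (containing ?H (insert x S))
      = card (B i - S) * card (containing ?H (insert x S))"
    using fin by (simp add: card_Diff_subset_Int Int_commute)
  also have "\<dots> = (\<Sum>y\<in>B i - S. card (containing ?H (insert x S)))" by simp
  also have "\<dots> = (\<Sum>y\<in>B i - S. card (containing ?H (insert y S)))"
    using i x card_containing_insert_le by (intro sum.cong refl order_antisym) blast+
  also have "\<dots> = (\<Sum>F\<in>containing ?H S. card (F \<inter> (B i - S)))"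
    using fin finite_layer by (intro sum_card_containing_insert) auto
  also have "\<dots> = (\<Sum>F\<in>containing ?H S. r i - card (S \<inter> B i))"
  proof (rule sum.cong)
    fix F assume F: "F \<in> containing ?H S"
    then have "F \<inter> (B i - S) = F \<inter> B i - S \<inter> B i" "S \<inter> B i \<subseteq> F \<inter> B i" "card (F \<inter> B i) = r i"
      using i by (auto simp: containing_def layer_def)
    then show "card (F \<inter> (B i - S)) = r i - card (S \<inter> B i)"
      using fin by (simp add: card_Diff_subset)
  qed simp
  finally show ?thesis by simp
qed

text \<open>If some member contains \<open>insert x S\<close>, then \<open>x\<close> lies in a block
  \<open>B i\<close> and the exact ratio is \<open>(r i - m) / (card (B i) - m)\<close> with
  \<open>m = card (S \<inter> B i) < r i\<close>. It is at most \<open>q\<close>, since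
  \<open>q \<le> 1\<close> lets \<open>r i \<le> q * card (B i)\<close> survive subtracting
  \<open>m\<close> from both sizes.\<close>

lemma layer_spread:
  assumes "x \<notin> S" and q: "0 \<le> q" and r: "\<And>i. i \<in> J \<Longrightarrow> real (r i) \<le> q * real (card (B i))"
    and q1: "q \<le> 1"
  shows "real (card (containing (layer J B r) (insert x S)))
    \<le> q * real (card (containing (layer J B r) S))"
proof (cases "containing (layer J B r) (insert x S) = {}")
  case True
  then show ?thesis using q by simp
next
  case False
  then obtain F where F: "F \<in> layer J B r" "insert x S \<subseteq> F" by (auto simp: containing_def)
  then obtain i where i: "i \<in> J" "x \<in> B i" by (auto simp: layer_def)
  let ?d = "real (card (containing (layer J B r) S))"
  let ?d' = "real (card (containing (layer J B r) (insert x S)))"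
  define m where "m = card (S \<inter> B i)"
  have fin: "finite (B i)" using i finite_block by blast
  have "card (insert x (S \<inter> B i)) \<le> card (F \<inter> B i)" using F i fin by (intro card_mono) auto
  then have mr: "m < r i" using F i assms(1) fin by (auto simp: m_def layer_def)
  have "card (F \<inter> B i) \<le> card (B i)" using fin by (intro card_mono) auto
  then have rn: "r i \<le> card (B i)" using F i by (auto simp: layer_def)
  have "real ((card (B i) - m) * card (containing (layer J B r) (insert x S)))
      = real ((r i - m) * card (containing (layer J B r) S))"
    unfolding m_def using card_containing_insert[of i x S r] i assms(1) by simp
  then have eq: "(real (card (B i)) - real m) * ?d' = (real (r i) - real m) * ?d"
    using mr rn by (simp add: of_nat_diff)
  have "q * real m \<le> real m" using q1 mult_right_mono[of q 1 "real m"] by simp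
  then have "real (r i) - real m \<le> q * (real (card (B i)) - real m)"
    using r[OF i(1)] by (simp add: right_diff_distrib)
  then have "(real (r i) - real m) * ?d \<le> (q * (real (card (B i)) - real m)) * ?d"
    by (intro mult_right_mono) auto
  then have "(real (card (B i)) - real m) * ?d' \<le> (real (card (B i)) - real m) * (q * ?d)"
    using eq by (simp add: algebra_simps)
  then show ?thesis using mr rn by (simp add: mult_le_cancel_left_pos)
qed

text \<open>A point added to a set of \<open>m < t\<close> points keeps the fraction
  \<open>(r i - m) / (card (B i) - m)\<close>, which is at least
  \<open>(t - m) / card (B i)\<close>. For \<open>card S = t\<close> the product of these is
  \<open>fact t / card (B i) ^ t\<close>; the statement is multiplied out to stay in the natural
  numbers.\<close>

lemma card_containing_in_block:
  assumes i: "i \<in> J" and t: "t \<le> r i" "r i \<le> card (B i)"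
    and S: "S \<subseteq> B i" "card S \<le> t"
  shows "fact t * card (layer J B r)
    \<le> card (B i) ^ card S * fact (t - card S) * card (containing (layer J B r) S)"
proof -
  have "finite S" using S i finite_block finite_subset by blast
  then show ?thesis using S
  proof (induction S rule: finite_induct)
    case empty
    then show ?case by simp
  next
    case (insert x S)
    let ?d = "card (containing (layer J B r) S)"
    let ?d' = "card (containing (layer J B r) (insert x S))"
    let ?n = "card (B i)" and ?m = "card S"
    have m: "?m < t" "card (insert x S) = Suc ?m" using insert by auto
    have "S \<inter> B i = S" using insert by auto
    then have "(?n - ?m) * ?d' = (r i - ?m) * ?d"
      using card_containing_insert[of i x S r] i insert by auto
    moreover have "(t - ?m) * ?d \<le> (r i - ?m) * ?d" using t by (intro mult_right_mono) auto
    moreover have "(?n - ?m) * ?d' \<le> ?n * ?d'" by (intro mult_right_mono) auto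
    ultimately have step: "(t - ?m) * ?d \<le> ?n * ?d'" by linarith
    have "fact (t - ?m) = (t - ?m) * fact (t - Suc ?m)"
      using m fact_reduce[of "t - ?m", where 'a = nat] by simp
    then have "fact t * card (layer J B r) \<le> ?n ^ ?m * ((t - ?m) * fact (t - Suc ?m)) * ?d"
      using insert by simp
    also have "\<dots> = ?n ^ ?m * fact (t - Suc ?m) * ((t - ?m) * ?d)" by simp
    also have "\<dots> \<le> ?n ^ ?m * fact (t - Suc ?m) * (?n * ?d')"
      using step by (intro mult_left_mono) auto
    also have "\<dots> = ?n ^ Suc ?m * fact (t - Suc ?m) * ?d'" by simp
    finally show ?case using m by simp
  qed
qed

end

section \<open>The consecutive blocks of the ground set\<close>

lemma block_eq: "block n i = {(\<Sum>j=1..i - 1. n j)<..(\<Sum>j=1..i. n j)}"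
  by (auto simp: block_def)

lemma sum_prefix_mono: "i \<le> j \<Longrightarrow> (\<Sum>l=1..i. n l) \<le> (\<Sum>l=1..j. n l)"
  for n :: "nat \<Rightarrow> nat"
  by (intro sum_mono2) auto

lemma card_block:
  assumes "1 \<le> i"
  shows "card (block n i) = n i"
proof -
  obtain m where "i = Suc m" using assms by (cases i) auto
  then show ?thesis by (simp add: block_eq)
qed

lemma disjoint_block:
  assumes "i < j"
  shows "block n i \<inter> block n j = {}"
proof -
  have "(\<Sum>l=1..i. n l) \<le> (\<Sum>l=1..j - 1. n l)"
    using assms by (intro sum_prefix_mono) simp
  then show ?thesis unfolding block_eq by (auto simp del: One_nat_def)
qed

lemma ground_eq_Union_block: "ground p n = (\<Union>i\<in>{1..p}. block n i)"
proof (induction p)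
  case 0
  then show ?case by (simp add: ground_def)
next
  case (Suc p)
  have "ground (Suc p) n = ground p n \<union> block n (Suc p)"
    by (auto simp: ground_def block_eq)
  then show ?case using Suc by (simp add: atLeastAtMostSuc_conv Un_commute)
qed

text \<open>It absorbs \<open>2 ^ Suc t - 1\<close> into \<open>2 * (t + 1) * fact t\<close>,
  matching the factor \<open>2 * (t + 1)\<close> in the hypothesis on block sizes.\<close>

lemma two_power_le_fact_Suc: "2 ^ t \<le> (fact (Suc t) :: nat)"
proof (induction t)
  case (Suc t)
  have "2 * 2 ^ t \<le> Suc (Suc t) * (fact (Suc t) :: nat)"
    using Suc by (intro mult_mono) auto
  then show ?case by simp
qed simp

theorem theorem1p4:
  fixes p t b c :: nat and n :: "nat \<Rightarrow> nat" and R :: "(nat \<Rightarrow> nat) set"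
    and \<F> :: "nat set set"
  assumes "p > 0" and "t > 0"
    and "\<And>i. i \<in> {1..p} \<Longrightarrow> n i > 0"
    and "R \<subseteq> pos_tuples p" and "R \<noteq> {}" and "finite R"
    and "b = Max (coords p R)" and "c = Min (coords p R)"
    and "t \<le> c"
    and "\<And>i. i \<in> {1..p} \<Longrightarrow> n i > 2 * (t + 1) * p * b ^ (t + 2)"
    and "max_t_intersecting_in t (H2 p n R) \<F>"
  shows "trivial_family t (ground p n) \<F>"
proof (rule ccontr)
  assume nontriv: "\<not> trivial_family t (ground p n) \<F>"
  let ?J = "{1..p}" and ?B = "block n"
  interpret block_system ?J ?B
  proof
    show "?B i \<inter> ?B j = {}" if "i \<noteq> j" for i j
      using that disjoint_block[of i j n] disjoint_block[of j i n] by (cases i j rule: linorder_cases) auto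
  qed (auto simp: block_def)
  have H2_eq: "H2 p n R = (\<Union>r\<in>R. layer ?J ?B r)"
    by (simp add: H2_def layer_def ground_eq_Union_block)
  have FH: "\<F> \<subseteq> H2 p n R" and tF: "t_intersecting t \<F>"
    and Fmax: "\<And>\<G>. \<G> \<subseteq> H2 p n R \<Longrightarrow> t_intersecting t \<G> \<Longrightarrow> card \<G> \<le> card \<F>"
    using assms(11) by (auto simp: max_t_intersecting_in_def)
  have "coords p R \<subseteq> (\<lambda>(r, i). r i) ` (R \<times> ?J)" by (force simp: coords_def)
  then have "finite (coords p R)" using \<open>finite R\<close> by (rule_tac finite_subset) auto
  then have r_bounds: "t \<le> r i" "r i \<le> b" if "r \<in> R" "i \<in> ?J" for r i
  proof -
    have "r i \<in> coords p R" using that by (auto simp: coords_def)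
    then have "c \<le> r i" "r i \<le> b"
      using \<open>finite (coords p R)\<close> assms(7,8) by simp_all
    then show "t \<le> r i" "r i \<le> b" using \<open>t \<le> c\<close> by simp_all
  qed
  obtain r0 where r0: "r0 \<in> R" using \<open>R \<noteq> {}\<close> by blast
  have tb: "t \<le> b" using r_bounds[OF r0, of 1] \<open>p > 0\<close> by simp
  have "Min (n ` ?J) \<in> n ` ?J" using \<open>p > 0\<close> by (intro Min_in) auto
  then obtain i0 where i0: "i0 \<in> ?J" "n i0 = Min (n ` ?J)" by auto
  have n_min: "n i0 \<le> n i" if "i \<in> ?J" for i using that i0(2) by simp
  \<comment> \<open>Dividing by the smallest block size bounds \<open>r i / n i\<close> for all
    \<open>r \<in> R\<close> and all blocks at once.\<close>
  define q where "q = real b / real (n i0)"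
  define k where "k = p * b"
  have n0: "real (n i0) > 0" using assms(3) i0 by simp
  have b1: "1 \<le> real b" using tb \<open>t > 0\<close> by simp
  have k1: "1 \<le> real k" using tb \<open>t > 0\<close> \<open>p > 0\<close> by (simp add: k_def flip: of_nat_mult)
  have q0: "0 \<le> q" using n0 by (simp add: q_def)
  \<comment> \<open>The size hypothesis for the smallest block, divided by \<open>n i0\<close>; here
    \<open>k * q = p * b ^ 2 / n i0\<close>.\<close>
  have kq: "2 * (real t + 1) * real b ^ t * (real k * q) < 1"
  proof -
    have "real (2 * (t + 1) * p * b ^ (t + 2)) < real (n i0)"
      using assms(10)[OF i0(1)] by (simp only: of_nat_less_iff)
    then have "2 * (real t + 1) * real p * real b ^ (t + 2) < real (n i0)" by (simp add: algebra_simps)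
    moreover have "2 * (real t + 1) * real b ^ t * (real k * q)
        = 2 * (real t + 1) * real p * real b ^ (t + 2) / real (n i0)"
      by (simp add: k_def q_def power2_eq_square)
    ultimately show ?thesis using n0 by (simp add: divide_less_eq)
  qed
  \<comment> \<open>Since \<open>t\<close> and \<open>b\<close> are at least 1, the factor in
    \<open>kq\<close> is at least 4; this yields the smallness conditions of
    \<open>spread_family\<close>.\<close>
  have kq4: "4 * (real k * q) < 1"
  proof -
    have "2 * 2 * 1 \<le> 2 * (real t + 1) * real b ^ t"
      using \<open>t > 0\<close> b1 by (intro mult_mono one_le_power) auto
    then have "4 * (real k * q) \<le> 2 * (real t + 1) * real b ^ t * (real k * q)"
      using q0 by (intro mult_right_mono) auto
    then show ?thesis using kq by linarith
  qed
  have qk: "q \<le> real k * q" using mult_right_mono[OF k1 q0] by simp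
  have r_le_q: "real (r i) \<le> q * real (card (?B i))" if "r \<in> R" "i \<in> ?J" for r i
  proof -
    have "real (r i) \<le> real b" using r_bounds that by simp
    also have "\<dots> = q * real (n i0)" using n0 by (simp add: q_def)
    also have "\<dots> \<le> q * real (n i)" using n_min that q0 by (intro mult_left_mono) auto
    finally show ?thesis using that card_block by simp
  qed
  have r_le_n: "r i \<le> card (?B i)" if "r \<in> R" "i \<in> ?J" for r i
  proof -
    have "q * real (card (?B i)) \<le> 1 * real (card (?B i))"
      using qk kq4 q0 by (intro mult_right_mono) auto
    then show ?thesis using r_le_q[OF that] by simp
  qed
  have card_le_k: "card F \<le> k" if "r \<in> R" "F \<in> layer ?J ?B r" for r F
  proof -
    have "card F = (\<Sum>i\<in>?J. r i)" using that by (intro card_layer_member)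
    also have "\<dots> \<le> (\<Sum>i\<in>?J. b)" using r_bounds that by (intro sum_mono) auto
    finally show ?thesis by (simp add: k_def)
  qed
  have "t \<le> card (?B i0)" using r_bounds[OF r0 i0(1)] r_le_n[OF r0 i0(1)] by simp
  then obtain T0 where T0: "T0 \<subseteq> ?B i0" "card T0 = t" "finite T0"
    by (rule obtain_subset_with_card_n)
  have less: "card (\<F> \<inter> layer ?J ?B r) < card (containing (layer ?J ?B r) T0)" if r: "r \<in> R" for r
  proof -
    let ?H = "layer ?J ?B r"
    interpret spread_family ?H k q
    proof
      show "finite ?H" by (rule finite_layer)
      show "finite F" "card F \<le> k" if "F \<in> ?H" for F
        using that finite_layer_member card_le_k r by blast+
      show "0 \<le> q" by (rule q0)
      show "4 * q \<le> 1" "2 * real k * q < 1" using kq4 qk q0 k1 by linarith+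
      show "real (card (containing ?H (insert x S))) \<le> q * real (card (containing ?H S))"
        if "x \<notin> S" for x S
        using that q0 r_le_q r qk kq4 by (intro layer_spread) auto
    qed
    let ?N = "real (card ?H)" and ?m = "real (n i0)"
    have Npos: "?N > 0"
      using layer_nonempty[of r] r_le_n r finite_layer by (simp add: card_gt_0_iff)
    have "real (card (\<F> \<inter> ?H)) \<le> (2 ^ Suc t - 1) * real k * q ^ Suc t * ?N"
    proof (rule nontrivial_card_bound)
      show "\<F> \<inter> ?H \<subseteq> ?H" by blast
      show "t_intersecting t (\<F> \<inter> ?H)" using tF by (simp add: t_intersecting_def)
      fix T :: "nat set" assume T: "finite T" "card T = t"
      obtain A where A: "A \<in> \<F>" "\<not> T \<subseteq> A"
      proof (cases "T \<subseteq> ground p n")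
        case True
        then show ?thesis using nontriv T that by (auto simp: trivial_family_def)
      next
        \<comment> \<open>A set reaching outside the ground set lies in no member, so any member
          serves as \<open>A\<close>. One exists because the empty family would be trivial, with
          \<open>T0\<close> as common set.\<close>
        case False
        have "\<F> \<noteq> {}"
        proof
          assume "\<F> = {}"
          moreover have "T0 \<subseteq> ground p n" using T0 i0 by (auto simp: ground_eq_Union_block)
          ultimately show False using nontriv T0 by (auto simp: trivial_family_def)
        qed
        then obtain A where "A \<in> \<F>" by blast
        moreover have "A \<subseteq> ground p n"
          using \<open>A \<in> \<F>\<close> FH by (auto simp: H2_def)
        ultimately show ?thesis using False that by blast
      qed
      \<comment> \<open>The witness may belong to another layer \<open>r'\<close>, but the size
        bound \<open>k\<close> is common to all layers.\<close>
      obtain r' where "r' \<in> R" "A \<in> layer ?J ?B r'" using A FH H2_eq by auto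
      then have "finite A" "card A \<le> k" using finite_layer_member card_le_k by blast+
      then show "\<exists>B. finite B \<and> card B \<le> k \<and> \<not> T \<subseteq> B \<and> (\<forall>A\<in>\<F> \<inter> ?H. t \<le> card (A \<inter> B))"
        using A tF by (auto simp: t_intersecting_def)
    qed
    \<comment> \<open>Multiplying by \<open>?m ^ t\<close> clears the denominators of
      \<open>q ^ t\<close> and leaves a single factor \<open>k * q\<close> for
      \<open>kq\<close>.\<close>
    then have "real (card (\<F> \<inter> ?H)) * ?m ^ t \<le> (2 ^ Suc t - 1) * real k * q ^ Suc t * ?N * ?m ^ t"
      by (intro mult_right_mono) auto
    also have "\<dots> = (2 ^ Suc t - 1) * (real b ^ t * (real k * q)) * ?N"
    proof -
      have "q ^ t * ?m ^ t = real b ^ t"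
        using n0 by (simp add: q_def power_divide)
      moreover have "(2 ^ Suc t - 1) * real k * q ^ Suc t * ?N * ?m ^ t
          = (2 ^ Suc t - 1) * ((q ^ t * ?m ^ t) * (real k * q)) * ?N" by simp
      ultimately show ?thesis by simp
    qed
    \<comment> \<open>By \<open>two_power_le_fact_Suc\<close> the coefficient is at most
      \<open>fact t\<close> times the quantity that \<open>kq\<close> puts below 1.\<close>
    also have "\<dots> < fact t * ?N"
    proof (rule mult_strict_right_mono[OF _ Npos])
      have "real (2 ^ t) \<le> real (fact (Suc t))"
        using two_power_le_fact_Suc[of t] by (simp only: of_nat_le_iff)
      then have "(2::real) ^ Suc t - 1 \<le> 2 * ((real t + 1) * fact t)" by (simp add: algebra_simps)
      then have "(2 ^ Suc t - 1) * (real b ^ t * (real k * q))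
          \<le> 2 * ((real t + 1) * fact t) * (real b ^ t * (real k * q))"
        using q0 by (intro mult_right_mono) auto
      also have "\<dots> = fact t * (2 * (real t + 1) * real b ^ t * (real k * q))" by simp
      also have "\<dots> < fact t * 1" using kq by (intro mult_strict_left_mono) auto
      finally show "(2 ^ Suc t - 1) * (real b ^ t * (real k * q)) < fact t" by simp
    qed
    also have "fact t * ?N \<le> ?m ^ t * real (card (containing ?H T0))"
    proof -
      have "fact t * card ?H \<le> n i0 ^ t * card (containing ?H T0)"
        using card_containing_in_block[of i0 t r T0] i0 r_bounds[OF r i0(1)] r_le_n[OF r i0(1)] T0
          card_block[of i0 n] by simp
      then have "real (fact t * card ?H) \<le> real (n i0 ^ t * card (containing ?H T0))"
        by (simp only: of_nat_le_iff)
      then show ?thesis by simp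
    qed
    finally show ?thesis using n0 by (simp add: mult.commute)
  qed
  have "\<F> = (\<Union>r\<in>R. \<F> \<inter> layer ?J ?B r)" using FH H2_eq by auto
  then have "card \<F> \<le> (\<Sum>r\<in>R. card (\<F> \<inter> layer ?J ?B r))"
    using card_UN_le[OF \<open>finite R\<close>] by metis
  also have "\<dots> < (\<Sum>r\<in>R. card (containing (layer ?J ?B r) T0))"
    using \<open>finite R\<close> \<open>R \<noteq> {}\<close> less by (intro sum_strict_mono) auto
  also have "\<dots> = card (\<Union>r\<in>R. containing (layer ?J ?B r) T0)"
  proof (rule card_UN_disjoint[symmetric])
    show "\<forall>r\<in>R. finite (containing (layer ?J ?B r) T0)"
      using finite_subset[OF containing_subset finite_layer] by blast
    show "\<forall>r\<in>R. \<forall>r'\<in>R. r \<noteq> r' \<longrightarrow>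
        containing (layer ?J ?B r) T0 \<inter> containing (layer ?J ?B r') T0 = {}"
    \<comment> \<open>The intersection sizes of \<open>F\<close> determine a tuple on
      \<open>?J\<close>, and extensionality determines it elsewhere.\<close>
    proof (intro ballI impI equals0I)
      fix r r' F
      assume r: "r \<in> R" "r' \<in> R" "r \<noteq> r'"
        and F: "F \<in> containing (layer ?J ?B r) T0 \<inter> containing (layer ?J ?B r') T0"
      have "r i = r' i" if "i \<in> ?J" for i
        using F that by (auto simp: containing_def layer_def)
      moreover have "r \<in> ?J \<rightarrow>\<^sub>E {0<..}" "r' \<in> ?J \<rightarrow>\<^sub>E {0<..}"
        using r assms(4) by (auto simp: pos_tuples_def)
      ultimately show False using r(3) PiE_ext by blast
    qed
  qed (rule \<open>finite R\<close>)
  \<comment> \<open>The star of \<open>T0\<close> over all layers is itself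
    \<open>t\<close>-intersecting, hence a competitor of the maximum family.\<close>
  also have "\<dots> \<le> card \<F>"
  proof (rule Fmax)
    show "(\<Union>r\<in>R. containing (layer ?J ?B r) T0) \<subseteq> H2 p n R"
      unfolding H2_eq using containing_subset by blast
    show "t_intersecting t (\<Union>r\<in>R. containing (layer ?J ?B r) T0)"
      unfolding t_intersecting_def
    proof (intro ballI)
      fix A A'
      assume A: "A \<in> (\<Union>r\<in>R. containing (layer ?J ?B r) T0)"
        and A': "A' \<in> (\<Union>r\<in>R. containing (layer ?J ?B r) T0)"
      have "finite A" "T0 \<subseteq> A \<inter> A'"
        using A A' finite_layer_member by (auto simp: containing_def)
      then show "t \<le> card (A \<inter> A')" using card_mono[of "A \<inter> A'" T0] T0 by simp
    qed
  qed
  finally show False by simp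
qed

end
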